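(* Let $F=f+\Psi$ where $f:\mathbb{R}^n\to\mathbb{R}$ is $L$-smooth (not necessarily convex, $L>0$) and $\Psi:\mathbb{R}^n\to\mathbb{R}\cup\{+\infty\}$ is closed, proper and convex, and suppose $F$ attains its minimum at a fixed point $\mathbf{x}^*$. Fix $\mathbf{x}_0\in\mathbb{R}^n$, and let $\{\mathbf{x}_k,\mathbf{y}_k,\mathbf{z}_k\}_{k\ge1}$ be generated by the idealized algorithm described in the context. Then for $k=1,2,\ldots$, $$F(\bar{\mathbf{x}}_k)\le F(\bar{\mathbf{x}}_{k-1})-\frac{1}{2L}\|G_{1/L}(\mathbf{x}_k)\|^2,\qquad\text{where } \bar{\mathbf{x}}_k=\mathbf{x}_k-\frac{G_{1/L}(\mathbf{x}_k)}{L}.$$ If, in addition, $f$ is convex, then for $k=1,2,\ldots$, $$\Phi_{k+1}\le\Phi_k,\qquad\text{where } \Phi_k=\|\mathbf{y}_k-\mathbf{x}^*\|^2+\frac{k(k+1)(F(\mathbf{x}_k)-F(\mathbf{x}^* ))}{2L}.$$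
   Context: $f$ is $L$-smooth if it is differentiable and $|f(\mathbf{x})-f(\mathbf{y})-\nabla f(\mathbf{y})^T(\mathbf{x}-\mathbf{y})|\le (L/2)\|\mathbf{x}-\mathbf{y}\|^2$ for all $\mathbf{x},\mathbf{y}$. For $t>0$, $\mathrm{prox}_{t\Psi}(\mathbf{x})=\operatorname{argmin}_{\mathbf{z}}\{\Psi(\mathbf{z})+\|\mathbf{x}-\mathbf{z}\|^2/(2t)\}$, and $G_t(\mathbf{x})=t^{-1}(\mathbf{x}-\mathrm{prox}_{t\Psi}(\mathbf{x}-t\nabla f(\mathbf{x})))$. Idealized algorithm (non-strongly convex and nonconvex case). Set $\mathbf{z}_0=\mathbf{x}_0$, and let $\mathcal{M}_1$ be any affine subspace containing $\mathbf{z}_0+\mathrm{span}\{G_{1/L}(\mathbf{z}_0)\}$. For $k=1,2,\ldots$: (1) $\mathbf{y}_k=\operatorname{argmin}\{\|\mathbf{y}-\mathbf{x}^*\|^2:\mathbf{y}\in\mathcal{M}_k\}$. (2) $\mathbf{x}_k\in\operatorname{argmin}\{F(\mathbf{x}):\mathbf{x}\in\mathcal{M}_k\}$ (a minimizer is assumed to exist). (3) $\mathbf{z}_k$ is any point of $\mathcal{M}_k$ with $G_{1/L}(\mathbf{z}_k)^T(\mathbf{y}_k-\mathbf{z}_k)\ge0$ and $-G_{1/L}(\mathbf{z}_k)^T(\mathbf{x}_k-\mathbf{z}_k)\le0$. (4) $\mathcal{M}_{k+1}$ is any affine subspace containing $\{\mathbf{z}_k+\mathrm{span}\{G_{1/L}(\mathbf{z}_k)\}\}\cup\{\mathbf{y}_k+\mathrm{span}\{G_{1/L}(\mathbf{z}_k)\}\}\cup\{\mathbf{x}_k+\mathrm{span}\{G_{1/L}(\mathbf{x}_k)\}\}$.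 *)

theory Defs
  imports "HOL-Analysis.Analysis"
begin

definition gradient :: "('a::real_inner \<Rightarrow> real) \<Rightarrow> 'a \<Rightarrow> 'a" where
  "gradient f x = (THE D. GDERIV f x :> D)"

definition L_smooth :: "real \<Rightarrow> ('a::euclidean_space \<Rightarrow> real) \<Rightarrow> bool" where
  "L_smooth L f \<longleftrightarrow> (\<forall>x. f differentiable (at x)) \<and>
     (\<forall>x y. \<bar>f x - f y - gradient f y \<bullet> (x - y)\<bar> \<le> (L / 2) * (norm (x - y))\<^sup>2)"

(* Functions into the reals with +infinity are ereal-valued functions that never take the value
   -infinity. The library's epigraph and convex_on only cover real-valued functions, so
   closedness and convexity are defined through the epigraph, a subset of 'a * real. *)

definition ext_epigraph :: "('a \<Rightarrow> ereal) \<Rightarrow> ('a \<times> real) set" where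
  "ext_epigraph \<Psi> = {(x, r). \<Psi> x \<le> ereal r}"

definition proper_fun :: "('a \<Rightarrow> ereal) \<Rightarrow> bool" where
  "proper_fun \<Psi> \<longleftrightarrow> (\<forall>x. \<Psi> x \<noteq> - \<infinity>) \<and> (\<exists>x. \<Psi> x \<noteq> \<infinity>)"

definition closed_fun :: "('a::euclidean_space \<Rightarrow> ereal) \<Rightarrow> bool" where
  "closed_fun \<Psi> \<longleftrightarrow> closed (ext_epigraph \<Psi>)"

definition convex_fun :: "('a::euclidean_space \<Rightarrow> ereal) \<Rightarrow> bool" where
  "convex_fun \<Psi> \<longleftrightarrow> convex (ext_epigraph \<Psi>)"

definition composite :: "('a \<Rightarrow> real) \<Rightarrow> ('a \<Rightarrow> ereal) \<Rightarrow> 'a \<Rightarrow> ereal" where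
  "composite f \<Psi> x = ereal (f x) + \<Psi> x"

(* ARG_MIN picks some minimizer; for t > 0 and closed proper convex \<Psi> it is the unique one. *)
definition prox :: "real \<Rightarrow> ('a::euclidean_space \<Rightarrow> ereal) \<Rightarrow> 'a \<Rightarrow> 'a" where
  "prox t \<Psi> x = (ARG_MIN (\<lambda>z. \<Psi> z + ereal ((norm (x - z))\<^sup>2 / (2 * t))) z. True)"

definition grad_map ::
  "('a::euclidean_space \<Rightarrow> real) \<Rightarrow> ('a \<Rightarrow> ereal) \<Rightarrow> real \<Rightarrow> 'a \<Rightarrow> 'a" where
  "grad_map f \<Psi> t x = (1 / t) *\<^sub>R (x - prox t \<Psi> (x - t *\<^sub>R gradient f x))"

(* The infinite sequences x, y, z, M form a possible run of the idealized algorithm, whose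
   nondeterministic choices (the subspaces M k, the minimizers x k, the points z k) are
   represented by constraints. Only indices k >= 1 of y and M are meaningful. *)
definition idealized_run ::
  "real \<Rightarrow> ('a::euclidean_space \<Rightarrow> real) \<Rightarrow> ('a \<Rightarrow> ereal) \<Rightarrow> 'a \<Rightarrow> 'a \<Rightarrow>
   (nat \<Rightarrow> 'a) \<Rightarrow> (nat \<Rightarrow> 'a) \<Rightarrow> (nat \<Rightarrow> 'a) \<Rightarrow> (nat \<Rightarrow> 'a set) \<Rightarrow> bool" where
  "idealized_run L f \<Psi> xstar x0 x y z M \<longleftrightarrow>
     (let G = grad_map f \<Psi> (1 / L); F = composite f \<Psi> in
       x 0 = x0 \<and> z 0 = x0 \<and>
       affine (M 1) \<and> (+) (z 0) ` span {G (z 0)} \<subseteq> M 1 \<and>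
       (\<forall>k\<ge>1.
          is_arg_min (\<lambda>u. (norm (u - xstar))\<^sup>2) (\<lambda>u. u \<in> M k) (y k) \<and>
          is_arg_min F (\<lambda>u. u \<in> M k) (x k) \<and>
          z k \<in> M k \<and>
          G (z k) \<bullet> (y k - z k) \<ge> 0 \<and>
          - (G (z k) \<bullet> (x k - z k)) \<le> 0 \<and>
          affine (M (k + 1)) \<and>
          (+) (z k) ` span {G (z k)} \<union> (+) (y k) ` span {G (z k)} \<union> (+) (x k) ` span {G (x k)}
            \<subseteq> M (k + 1)))"

definition xbar ::
  "real \<Rightarrow> ('a::euclidean_space \<Rightarrow> real) \<Rightarrow> ('a \<Rightarrow> ereal) \<Rightarrow> (nat \<Rightarrow> 'a) \<Rightarrow> nat \<Rightarrow> 'a" where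
  "xbar L f \<Psi> x k = x k - (1 / L) *\<^sub>R grad_map f \<Psi> (1 / L) (x k)"

definition potential ::
  "real \<Rightarrow> ('a::euclidean_space \<Rightarrow> real) \<Rightarrow> ('a \<Rightarrow> ereal) \<Rightarrow> 'a \<Rightarrow>
   (nat \<Rightarrow> 'a) \<Rightarrow> (nat \<Rightarrow> 'a) \<Rightarrow> nat \<Rightarrow> ereal" where
  "potential L f \<Psi> xstar x y k =
     ereal ((norm (y k - xstar))\<^sup>2) +
     ereal (real k * (real k + 1)) * (composite f \<Psi> (x k) - composite f \<Psi> xstar) / ereal (2 * L)"

end

theory Submission
  imports Defs
begin

text \<open>
  Optimality of \<open>p = prox t \<Psi> (x - t \<nabla>f x)\<close> gives the subgradient inequality
  \<open>\<Psi> u \<ge> \<Psi> p + (G x - \<nabla>f x) \<bullet> (u - p)\<close>; with the quadratic upper bound on \<open>f\<close> at step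
  \<open>t = 1 / L\<close> this becomes
  \<open>F p + G x \<bullet> (u - x) + \<parallel>G x\<parallel>\<^sup>2 / (2 L) \<le> f x + \<nabla>f x \<bullet> (u - x) + \<Psi> u\<close>.
  Taking \<open>u = x\<close> yields the descent claim, since the previous proximal point lies in \<open>M k\<close>.
  For convex \<open>f\<close> the right-hand side is at most \<open>F u\<close>; the instances \<open>u = xstar\<close> and \<open>u = x k\<close>
  at the point \<open>z k\<close>, combined with testing the minimality of \<open>y (k + 1)\<close> against
  \<open>y k - (k + 1) / (2 L) *\<^sub>R G (z k)\<close>, yield monotonicity of the potential.
\<close>

section \<open>Existence of the proximal point\<close>

lemma le_if_le_add_mult_small:
  fixes a b C :: real
  assumes "\<And>\<theta>. 0 < \<theta> \<Longrightarrow> \<theta> \<le> 1 \<Longrightarrow> a \<le> b + \<theta> * C"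
  shows "a \<le> b"
proof (rule field_le_epsilon)
  fix e :: real assume "0 < e"
  define \<theta> where "\<theta> = min 1 (e / (\<bar>C\<bar> + 1))"
  have \<theta>: "0 < \<theta>" "\<theta> \<le> 1" "\<theta> \<le> e / (\<bar>C\<bar> + 1)"
    using \<open>0 < e\<close> by (auto simp: \<theta>_def)
  have "\<theta> * C \<le> \<theta> * (\<bar>C\<bar> + 1)"
    using \<theta>(1) by (intro mult_left_mono) auto
  also have "\<dots> \<le> e"
    using \<theta>(3) by (simp add: field_simps)
  finally show "a \<le> b + e"
    using assms[OF \<theta>(1,2)] by linarith
qed

lemma proper_fun_finite_point:
  assumes "proper_fun \<Psi>"
  obtains a r where "\<Psi> a = ereal r"
  using assms unfolding proper_fun_def by (metis ereal_cases)

text \<open>A hyperplane separates the closed convex epigraph from a point just below it. That point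
  and the epigraph point above it differ only in the last coordinate, so the hyperplane is not
  vertical and is the graph of an affine function.\<close>

lemma convex_fun_affine_minorant:
  fixes \<Psi> :: "'a::euclidean_space \<Rightarrow> ereal"
  assumes "proper_fun \<Psi>" "closed_fun \<Psi>" "convex_fun \<Psi>"
  obtains w b where "\<And>z s. \<Psi> z \<le> ereal s \<Longrightarrow> w \<bullet> z + b \<le> s"
proof -
  obtain a r where a: "\<Psi> a = ereal r"
    using assms(1) by (rule proper_fun_finite_point)
  have "(a, r - 1) \<notin> ext_epigraph \<Psi>"
    by (simp add: ext_epigraph_def a)
  then obtain n c where sep: "n \<bullet> (a, r - 1) < c" "\<And>q. q \<in> ext_epigraph \<Psi> \<Longrightarrow> c < n \<bullet> q"
    using separating_hyperplane_closed_point[of "ext_epigraph \<Psi>" "(a, r - 1)"] assms(2,3)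
    unfolding closed_fun_def convex_fun_def by blast
  obtain n1 n2 where n: "n = (n1, n2)" by (cases n)
  have "c < n1 \<bullet> a + n2 * r"
    using sep(2)[of "(a, r)"] by (simp add: ext_epigraph_def a n)
  with sep(1) have "n2 > 0" by (simp add: n algebra_simps)
  have "(- (1 / n2) *\<^sub>R n1) \<bullet> z + c / n2 \<le> s" if "\<Psi> z \<le> ereal s" for z s
    using sep(2)[of "(z, s)"] that \<open>n2 > 0\<close>
    by (simp add: ext_epigraph_def n field_simps)
  then show ?thesis by (rule that)
qed

lemma bounded_quadratic_sublevel:
  fixes w v :: "'a::euclidean_space"
  assumes "c > 0"
  shows "bounded {z. w \<bullet> z + c * (norm (v - z))\<^sup>2 \<le> K}"
proof -
  define J where "J = \<bar>K - w \<bullet> v\<bar>"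
  \<comment> \<open>Beyond distance 1 the constant \<open>J\<close> is at most
    \<open>J * norm (v - z)\<close>; beyond the second bound the quadratic term outgrows
    \<open>(norm w + J) * norm (v - z)\<close>.\<close>
  define B where "B = max 1 ((norm w + J) / c)"
  have "dist v z \<le> B" if z: "w \<bullet> z + c * (norm (v - z))\<^sup>2 \<le> K" for z
  proof (rule ccontr)
    assume "\<not> dist v z \<le> B"
    then have N: "1 < norm (v - z)" "(norm w + J) / c < norm (v - z)"
      by (auto simp: B_def dist_norm)
    have "w \<bullet> (v - z) \<le> norm w * norm (v - z)"
      by (rule norm_cauchy_schwarz)
    with z have "c * (norm (v - z))\<^sup>2 \<le> J + norm w * norm (v - z)"
      by (simp add: J_def inner_diff_right)
    also have "\<dots> \<le> (norm w + J) * norm (v - z)"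
      using N(1) mult_left_mono[of 1 "norm (v - z)" J] by (simp add: J_def algebra_simps)
    also have "\<dots> < (c * norm (v - z)) * norm (v - z)"
      using N assms by (intro mult_strict_right_mono) (auto simp: field_simps)
    finally show False by (simp add: power2_eq_square)
  qed
  then show ?thesis by (auto simp: bounded_def)
qed

text \<open>The objective need not be continuous in \<open>z\<close>, but its lift
  \<open>\<phi>\<close> to the closed epigraph is. The affine minorant makes a sublevel set of
  \<open>\<phi>\<close> compact, so a minimum is attained there.\<close>

lemma prox_is_arg_min:
  fixes \<Psi> :: "'a::euclidean_space \<Rightarrow> ereal"
  assumes "t > 0" "proper_fun \<Psi>" "closed_fun \<Psi>" "convex_fun \<Psi>"
  shows "is_arg_min (\<lambda>z. \<Psi> z + ereal ((norm (v - z))\<^sup>2 / (2 * t))) (\<lambda>_. True) (prox t \<Psi> v)"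
proof -
  define E where "E = ext_epigraph \<Psi>"
  define \<phi> where "\<phi> q = snd q + 1 / (2 * t) * (norm (v - fst q))\<^sup>2" for q :: "'a \<times> real"
  obtain a r where a: "\<Psi> a = ereal r"
    using assms(2) by (rule proper_fun_finite_point)
  then have aE: "(a, r) \<in> E" by (simp add: E_def ext_epigraph_def)
  obtain w b where wb: "\<And>z s. \<Psi> z \<le> ereal s \<Longrightarrow> w \<bullet> z + b \<le> s"
    using convex_fun_affine_minorant[OF assms(2-4)] by blast
  define K where "K = \<phi> (a, r)"
  define Z where "Z = {z. w \<bullet> z + 1 / (2 * t) * (norm (v - z))\<^sup>2 \<le> K - b}"
  define S where "S = {q \<in> E. \<phi> q \<le> K}"
  have "bounded Z"
    unfolding Z_def using assms(1) by (intro bounded_quadratic_sublevel) simp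
  then have "bounded ((\<lambda>z. w \<bullet> z) ` Z)"
    by (intro bounded_linear_image bounded_linear_inner_right)
  then obtain R where R: "\<And>z. z \<in> Z \<Longrightarrow> \<bar>w \<bullet> z\<bar> \<le> R"
    unfolding bounded_iff by auto
  \<comment> \<open>The minorant confines \<open>z\<close> to the bounded set \<open>Z\<close> and
    bounds the height \<open>s\<close> below; the nonnegative quadratic term bounds \<open>s\<close>
    above by \<open>K\<close>.\<close>
  have "S \<subseteq> Z \<times> {- R + b .. K}"
  proof
    fix q assume "q \<in> S"
    then obtain z s where q: "q = (z, s)" "\<Psi> z \<le> ereal s"
      "s + 1 / (2 * t) * (norm (v - z))\<^sup>2 \<le> K"
      by (cases q) (auto simp: S_def E_def ext_epigraph_def \<phi>_def)
    have "0 \<le> 1 / (2 * t) * (norm (v - z))\<^sup>2" using assms(1) by simp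
    moreover have zZ: "z \<in> Z" using wb[OF q(2)] q(3) by (simp add: Z_def)
    ultimately show "q \<in> Z \<times> {- R + b .. K}"
      using wb[OF q(2)] q(3) R[OF zZ] by (auto simp: q(1))
  qed
  then have "bounded S"
    using \<open>bounded Z\<close> bounded_subset bounded_Times bounded_closed_interval by metis
  moreover have "closed S"
  proof -
    have "closed {q. \<phi> q \<le> K}"
      unfolding \<phi>_def by (intro closed_Collect_le continuous_intros)
    moreover have "closed E" using assms(3) by (simp add: E_def closed_fun_def)
    moreover have "S = E \<inter> {q. \<phi> q \<le> K}" by (auto simp: S_def)
    ultimately show ?thesis by auto
  qed
  ultimately have "compact S" by (simp add: compact_eq_bounded_closed)
  moreover have "(a, r) \<in> S" using aE by (simp add: S_def K_def)
  moreover have "continuous_on S \<phi>" unfolding \<phi>_def by (intro continuous_intros)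
  ultimately obtain q where q: "q \<in> S" "\<And>q'. q' \<in> S \<Longrightarrow> \<phi> q \<le> \<phi> q'"
    using continuous_attains_inf[of S \<phi>] by blast
  then have qmin: "\<phi> q \<le> \<phi> q'" if "q' \<in> E" for q'
    using that by (cases "\<phi> q' \<le> K") (auto simp: S_def)
  obtain p s where ps: "q = (p, s)" by (cases q)
  have "\<Psi> p \<le> ereal s" using q(1) by (simp add: ps S_def E_def ext_epigraph_def)
  have "\<Psi> p + ereal ((norm (v - p))\<^sup>2 / (2 * t)) \<le> \<Psi> u + ereal ((norm (v - u))\<^sup>2 / (2 * t))" for u
  proof (cases "\<Psi> u")
    case (real s')
    then have "\<phi> (p, s) \<le> \<phi> (u, s')"
      using qmin[of "(u, s')"] by (simp add: ps E_def ext_epigraph_def)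
    then have "ereal s + ereal ((norm (v - p))\<^sup>2 / (2 * t)) \<le> \<Psi> u + ereal ((norm (v - u))\<^sup>2 / (2 * t))"
      by (simp add: \<phi>_def real)
    then show ?thesis
      using \<open>\<Psi> p \<le> ereal s\<close> by (meson add_right_mono order_trans)
  qed (use assms(2) in \<open>auto simp: proper_fun_def\<close>)
  then have "\<exists>p. is_arg_min (\<lambda>z. \<Psi> z + ereal ((norm (v - z))\<^sup>2 / (2 * t))) (\<lambda>_. True) p"
    by (auto simp: is_arg_min_linorder)
  then show ?thesis
    unfolding prox_def arg_min_def by (rule someI_ex)
qed

section \<open>Inequalities for the proximal gradient step\<close>

text \<open>Minimality of \<open>p\<close> is tested at
  \<open>p + \<theta> *\<^sub>R (u - p)\<close>; dividing by \<theta> and letting it tend to 0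
  leaves the first-order terms. Real upper bounds \<open>s\<close> of \<open>\<Psi> u\<close> keep
  the arithmetic real.\<close>

lemma prox_subgradient:
  fixes \<Psi> :: "'a::euclidean_space \<Rightarrow> ereal" and v :: 'a
  assumes "t > 0" "proper_fun \<Psi>" "closed_fun \<Psi>" "convex_fun \<Psi>"
  defines "p \<equiv> prox t \<Psi> v"
  obtains r where "\<Psi> p = ereal r"
    "\<And>u s. \<Psi> u \<le> ereal s \<Longrightarrow> r + (v - p) \<bullet> (u - p) / t \<le> s"
proof -
  have min: "\<Psi> p + ereal ((norm (v - p))\<^sup>2 / (2 * t)) \<le> \<Psi> u + ereal ((norm (v - u))\<^sup>2 / (2 * t))" for u
    using prox_is_arg_min[OF assms(1-4)] by (simp add: is_arg_min_linorder p_def)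
  obtain a r0 where a: "\<Psi> a = ereal r0"
    using assms(2) by (rule proper_fun_finite_point)
  obtain r where r: "\<Psi> p = ereal r"
    using min[of a] assms(2) by (cases "\<Psi> p") (auto simp: a proper_fun_def)
  have "r + (v - p) \<bullet> (u - p) / t \<le> s" if us: "\<Psi> u \<le> ereal s" for u s
  proof (rule le_if_le_add_mult_small)
    fix \<theta> :: real assume \<theta>: "0 < \<theta>" "\<theta> \<le> 1"
    have "(1 - \<theta>) *\<^sub>R (p, r) + \<theta> *\<^sub>R (u, s) \<in> ext_epigraph \<Psi>"
      using assms(4) us \<theta> unfolding convex_fun_def
      by (intro convexD) (auto simp: ext_epigraph_def r)
    then have "\<Psi> (p + \<theta> *\<^sub>R (u - p)) \<le> ereal (r + \<theta> * (s - r))"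
      by (simp add: ext_epigraph_def algebra_simps)
    then have "\<Psi> p + ereal ((norm (v - p))\<^sup>2 / (2 * t))
        \<le> ereal (r + \<theta> * (s - r)) + ereal ((norm (v - (p + \<theta> *\<^sub>R (u - p))))\<^sup>2 / (2 * t))"
      using min[of "p + \<theta> *\<^sub>R (u - p)"] by (meson add_right_mono order_trans)
    then have "(norm (v - p))\<^sup>2 / (2 * t)
        \<le> \<theta> * (s - r) + (norm (v - p - \<theta> *\<^sub>R (u - p)))\<^sup>2 / (2 * t)"
      by (simp add: r diff_diff_eq)
    moreover have "(norm (v - p - \<theta> *\<^sub>R (u - p)))\<^sup>2
        = (norm (v - p))\<^sup>2 - 2 * \<theta> * ((v - p) \<bullet> (u - p)) + \<theta>\<^sup>2 * (norm (u - p))\<^sup>2"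
      unfolding power2_norm_eq_inner
      by (simp add: inner_diff_left inner_diff_right inner_commute power2_eq_square algebra_simps)
    ultimately have "0 \<le> \<theta> * (s - r - (v - p) \<bullet> (u - p) / t + \<theta> * ((norm (u - p))\<^sup>2 / (2 * t)))"
      using assms(1) by (simp add: field_simps power2_eq_square)
    then show "r + (v - p) \<bullet> (u - p) / t \<le> s + \<theta> * ((norm (u - p))\<^sup>2 / (2 * t))"
      using \<theta>(1) by (simp add: zero_le_mult_iff)
  qed
  with r show ?thesis by (rule that)
qed

lemma proximal_gradient_step:
  fixes f :: "'a::euclidean_space \<Rightarrow> real" and \<Psi> :: "'a \<Rightarrow> ereal"
  assumes "L > 0" "L_smooth L f" "proper_fun \<Psi>" "closed_fun \<Psi>" "convex_fun \<Psi>"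
  defines "G \<equiv> grad_map f \<Psi> (1 / L)"
  obtains d where "composite f \<Psi> (x - (1 / L) *\<^sub>R G x) = ereal d"
    "\<And>u s. \<Psi> u \<le> ereal s \<Longrightarrow>
      d + G x \<bullet> (u - x) + (norm (G x))\<^sup>2 / (2 * L) \<le> f x + gradient f x \<bullet> (u - x) + s"
proof -
  define g where "g = gradient f x"
  define v where "v = x - (1 / L) *\<^sub>R g"
  define p where "p = prox (1 / L) \<Psi> v"
  have p_eq: "p = x - (1 / L) *\<^sub>R G x"
    using assms(1) by (simp add: G_def grad_map_def p_def v_def g_def)
  obtain r where r: "\<Psi> p = ereal r"
    "\<And>u s. \<Psi> u \<le> ereal s \<Longrightarrow> r + (v - p) \<bullet> (u - p) / (1 / L) \<le> s"
    using prox_subgradient[of "1 / L" \<Psi> v] assms(1,3-5) unfolding p_def by auto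
  have vp: "v - p = (1 / L) *\<^sub>R (G x - g)"
    by (simp add: v_def p_eq algebra_simps)
  have "f p \<le> f x + g \<bullet> (p - x) + (L / 2) * (norm (p - x))\<^sup>2"
    using assms(2) unfolding L_smooth_def g_def by (smt (verit))
  also have "(norm (p - x))\<^sup>2 = (norm (G x))\<^sup>2 / L\<^sup>2"
    using assms(1) by (simp add: p_eq power_divide)
  finally have fp: "f p \<le> f x + g \<bullet> (p - x) + (norm (G x))\<^sup>2 / (2 * L)"
    using assms(1) by (simp add: power2_eq_square)
  have "f p + r + G x \<bullet> (u - x) + (norm (G x))\<^sup>2 / (2 * L) \<le> f x + g \<bullet> (u - x) + s"
    if "\<Psi> u \<le> ereal s" for u s
  proof -
    have up: "u - p = (u - x) + (1 / L) *\<^sub>R G x" by (simp add: p_eq)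
    have "r + (G x - g) \<bullet> (u - p) \<le> s"
      using r(2)[OF that] assms(1) by (simp add: vp)
    moreover have "G x \<bullet> (u - p) = G x \<bullet> (u - x) + (norm (G x))\<^sup>2 / L"
      by (simp add: up inner_add_right power2_norm_eq_inner)
    moreover have "g \<bullet> (u - p) + g \<bullet> (p - x) = g \<bullet> (u - x)"
      by (simp add: inner_diff_right)
    \<comment> \<open>One half absorbs the quadratic error in \<open>fp\<close>; the other half
      survives in the conclusion.\<close>
    moreover have "(norm (G x))\<^sup>2 / L = 2 * ((norm (G x))\<^sup>2 / (2 * L))" by simp
    ultimately show ?thesis using fp by (simp only: inner_diff_left)
  qed
  moreover have "composite f \<Psi> (x - (1 / L) *\<^sub>R G x) = ereal (f p + r)"
    using r(1) by (simp add: composite_def p_eq)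
  ultimately show ?thesis using that unfolding g_def by blast
qed

text \<open>
  The quadratic bound already identifies \<open>gradient f x\<close> as a subgradient, so the description of
  \<open>gradient\<close> through \<open>GDERIV\<close> is never needed.
\<close>

lemma convex_L_smooth_gradient:
  fixes f :: "'a::euclidean_space \<Rightarrow> real"
  assumes "L_smooth L f" "convex_on UNIV f"
  shows "f x + gradient f x \<bullet> (u - x) \<le> f u"
proof (rule le_if_le_add_mult_small)
  fix \<theta> :: real assume \<theta>: "0 < \<theta>" "\<theta> \<le> 1"
  have "f (x + \<theta> *\<^sub>R (u - x)) \<le> (1 - \<theta>) * f x + \<theta> * f u"
    using convex_onD[OF assms(2), of \<theta> x u] \<theta> by (simp add: algebra_simps)
  moreover have "\<bar>f (x + \<theta> *\<^sub>R (u - x)) - f x - gradient f x \<bullet> (x + \<theta> *\<^sub>R (u - x) - x)\<bar>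
      \<le> (L / 2) * (norm (x + \<theta> *\<^sub>R (u - x) - x))\<^sup>2"
    using assms(1) unfolding L_smooth_def by blast
  then have "f x + \<theta> * (gradient f x \<bullet> (u - x)) - (L / 2) * (\<theta>\<^sup>2 * (norm (u - x))\<^sup>2)
      \<le> f (x + \<theta> *\<^sub>R (u - x))"
    using \<theta>(1) unfolding abs_le_iff by (simp add: power_mult_distrib)
  ultimately have "\<theta> * (f x + gradient f x \<bullet> (u - x))
      \<le> \<theta> * (f u + \<theta> * ((L / 2) * (norm (u - x))\<^sup>2))"
    by (simp add: algebra_simps power2_eq_square)
  then show "f x + gradient f x \<bullet> (u - x) \<le> f u + \<theta> * ((L / 2) * (norm (u - x))\<^sup>2)"
    using \<theta>(1) by simp
qed

lemma proximal_gradient_descent: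
  fixes f :: "'a::euclidean_space \<Rightarrow> real" and \<Psi> :: "'a \<Rightarrow> ereal"
  assumes "L > 0" "L_smooth L f" "proper_fun \<Psi>" "closed_fun \<Psi>" "convex_fun \<Psi>"
  defines "G \<equiv> grad_map f \<Psi> (1 / L)"
  shows "composite f \<Psi> (x - (1 / L) *\<^sub>R G x)
    \<le> composite f \<Psi> x - ereal (1 / (2 * L) * (norm (G x))\<^sup>2)"
proof -
  obtain d where d: "composite f \<Psi> (x - (1 / L) *\<^sub>R G x) = ereal d"
    "\<And>u s. \<Psi> u \<le> ereal s \<Longrightarrow>
      d + G x \<bullet> (u - x) + (norm (G x))\<^sup>2 / (2 * L) \<le> f x + gradient f x \<bullet> (u - x) + s"
    using proximal_gradient_step[OF assms(1-5)] unfolding G_def by blast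
  show ?thesis
  proof (cases "\<Psi> x")
    case (real s)
    then show ?thesis using d(2)[of x s] unfolding d(1) by (simp add: composite_def)
  \<comment> \<open>If \<open>\<Psi> x\<close> is infinite, so is the right-hand side.\<close>
  qed (use assms(3) in \<open>auto simp: composite_def proper_fun_def\<close>)
qed

lemma proximal_gradient_convex:
  fixes f :: "'a::euclidean_space \<Rightarrow> real" and \<Psi> :: "'a \<Rightarrow> ereal"
  assumes "L > 0" "L_smooth L f" "proper_fun \<Psi>" "closed_fun \<Psi>" "convex_fun \<Psi>"
    and "convex_on UNIV f"
  defines "G \<equiv> grad_map f \<Psi> (1 / L)"
  obtains d where "composite f \<Psi> (x - (1 / L) *\<^sub>R G x) = ereal d"
    "\<And>u c. composite f \<Psi> u = ereal c \<Longrightarrow> d + G x \<bullet> (u - x) + (norm (G x))\<^sup>2 / (2 * L) \<le> c"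
proof -
  obtain d where d: "composite f \<Psi> (x - (1 / L) *\<^sub>R G x) = ereal d"
    "\<And>u s. \<Psi> u \<le> ereal s \<Longrightarrow>
      d + G x \<bullet> (u - x) + (norm (G x))\<^sup>2 / (2 * L) \<le> f x + gradient f x \<bullet> (u - x) + s"
    using proximal_gradient_step[OF assms(1-5)] unfolding G_def by blast
  have "d + G x \<bullet> (u - x) + (norm (G x))\<^sup>2 / (2 * L) \<le> c" if "composite f \<Psi> u = ereal c" for u c
  proof -
    have "\<Psi> u = ereal (c - f u)"
      using that by (cases "\<Psi> u") (auto simp: composite_def)
    then show ?thesis
      using d(2)[of u "c - f u"] convex_L_smooth_gradient[OF assms(2,6), of x u] by simp
  qed
  with d(1) show ?thesis by (rule that)
qed

section \<open>Monotonicity along the algorithm\<close>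

text \<open>After scaling by \<open>2 * L\<close>, the bound on \<open>a\<close> has weight
  \<open>2 * (k + 1)\<close> and that on \<open>e\<close> weight \<open>k * (k + 1)\<close>; these
  add up to \<open>(k + 1) * (k + 2)\<close>, the weight of \<open>d\<close> as a bound for
  \<open>e'\<close>.\<close>

lemma potential_arith:
  fixes k L A B a d q e e' :: real
  assumes "L > 0" "k \<ge> 0" "q \<ge> 0"
    and "a \<ge> d + q" "e \<ge> d + q" "e' \<le> d"
    and "B \<le> A - 2 * ((k + 1) / (2 * L)) * a + ((k + 1) / (2 * L))\<^sup>2 * (2 * L * q)"
  shows "B + (k + 1) * (k + 2) * e' / (2 * L) \<le> A + k * (k + 1) * e / (2 * L)"
proof -
  have "(k + 1) * (k + 2) * e' \<le> (k + 1) * (k + 2) * d"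
    "k * (k + 1) * (d + q) \<le> k * (k + 1) * e" "(k + 1) * (d + q) \<le> (k + 1) * a"
    using assms by (auto intro!: mult_left_mono)
  \<comment> \<open>The surplus of \<open>q\<close>: \<open>(k + 1) * (k + 2)\<close> copies are
    gained and \<open>(k + 1)\<^sup>2\<close> are spent.\<close>
  moreover have "0 \<le> (k + 1) * q" using assms(2,3) by simp
  moreover have "2 * L * B \<le> 2 * L * A - 2 * ((k + 1) * a) + (k + 1)\<^sup>2 * q"
  proof -
    have "2 * L * (A - 2 * ((k + 1) / (2 * L)) * a + ((k + 1) / (2 * L))\<^sup>2 * (2 * L * q))
        = 2 * L * A - 2 * ((k + 1) * a) + (k + 1)\<^sup>2 * q"
      using assms(1) by (simp add: field_simps power2_eq_square)
    then show ?thesis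
      using mult_left_mono[OF assms(7), of "2 * L"] assms(1) by simp
  qed
  ultimately have "2 * L * B + (k + 1) * (k + 2) * e' \<le> 2 * L * A + k * (k + 1) * e"
    by (simp add: algebra_simps power2_eq_square)
  then have "(2 * L * B + (k + 1) * (k + 2) * e') / (2 * L) \<le> (2 * L * A + k * (k + 1) * e) / (2 * L)"
    using assms(1) by (intro divide_right_mono) auto
  then show ?thesis using assms(1) by (simp add: add_divide_distrib)
qed

theorem theorem7p1:
  fixes f :: "real ^ 'n \<Rightarrow> real"
    and \<Psi> :: "real ^ 'n \<Rightarrow> ereal"
    and L :: real
    and xstar x0 :: "real ^ 'n"
    and x y z :: "nat \<Rightarrow> real ^ 'n"
    and M :: "nat \<Rightarrow> (real ^ 'n) set"
  assumes "L > 0"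
    and "L_smooth L f"
    and "proper_fun \<Psi>" and "closed_fun \<Psi>" and "convex_fun \<Psi>"
    and "is_arg_min (composite f \<Psi>) (\<lambda>_. True) xstar"
    and "idealized_run L f \<Psi> xstar x0 x y z M"
  shows "(\<forall>k\<ge>1. composite f \<Psi> (xbar L f \<Psi> x k)
            \<le> composite f \<Psi> (xbar L f \<Psi> x (k - 1))
               - ereal (1 / (2 * L) * (norm (grad_map f \<Psi> (1 / L) (x k)))\<^sup>2))
       \<and> (convex_on UNIV f \<longrightarrow>
            (\<forall>k\<ge>1. potential L f \<Psi> xstar x y (k + 1) \<le> potential L f \<Psi> xstar x y k))"
proof -
  note hyps = assms(1-5)
  define G where "G = grad_map f \<Psi> (1 / L)"
  define F where "F = composite f \<Psi>"
  have line: "a - c *\<^sub>R b \<in> (+) a ` span {b}" for a b :: "real ^ 'n" and c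
  proof (rule image_eqI)
    show "- c *\<^sub>R b \<in> span {b}" by (intro span_mul span_base) simp
  qed simp
  have M1: "x 0 = z 0" "(+) (z 0) ` span {G (z 0)} \<subseteq> M 1"
    and ymin: "\<And>k u. k \<ge> 1 \<Longrightarrow> u \<in> M k \<Longrightarrow> (norm (y k - xstar))\<^sup>2 \<le> (norm (u - xstar))\<^sup>2"
    and xmin: "\<And>k u. k \<ge> 1 \<Longrightarrow> u \<in> M k \<Longrightarrow> F (x k) \<le> F u"
    and Gy: "\<And>k. k \<ge> 1 \<Longrightarrow> 0 \<le> G (z k) \<bullet> (y k - z k)"
    and Gx: "\<And>k. k \<ge> 1 \<Longrightarrow> 0 \<le> G (z k) \<bullet> (x k - z k)"
    and M: "\<And>k. k \<ge> 1 \<Longrightarrow> (+) (z k) ` span {G (z k)} \<subseteq> M (k + 1)"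
      "\<And>k. k \<ge> 1 \<Longrightarrow> (+) (y k) ` span {G (z k)} \<subseteq> M (k + 1)"
      "\<And>k. k \<ge> 1 \<Longrightarrow> (+) (x k) ` span {G (x k)} \<subseteq> M (k + 1)"
    using assms(7)
    unfolding idealized_run_def Let_def is_arg_min_linorder G_def[symmetric] F_def[symmetric]
    by auto
  \<comment> \<open>For \<open>k = 1\<close> the line through \<open>z 0\<close> serves, as
    \<open>x 0 = z 0\<close>; later subspaces contain the line through
    \<open>x (k - 1)\<close>.\<close>
  have xbar_in: "xbar L f \<Psi> x (k - 1) \<in> M k" if "k \<ge> 1" for k
  proof (cases "k = 1")
    case True
    then show ?thesis
      using M1(2)[THEN subsetD, OF line, of "1 / L"] M1(1) by (simp add: xbar_def G_def)
  next
    case False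
    then show ?thesis
      using M(3)[of "k - 1", THEN subsetD, OF _ line, of "1 / L"] that
      by (simp add: xbar_def G_def)
  qed
  have F_xstar: "F xstar \<le> F u" for u
    using assms(6) by (simp add: is_arg_min_linorder F_def)
  have F_minf: "F u \<noteq> - \<infinity>" for u
    using assms(3) by (cases "\<Psi> u") (auto simp: F_def composite_def proper_fun_def)
  \<comment> \<open>A proximal step lands where \<Psi> is finite even if \<open>F x0\<close> is
    infinite, which makes every \<open>F (x k)\<close> with \<open>k \<ge> 1\<close> finite.\<close>
  have F_xbar: "F (xbar L f \<Psi> x k) \<noteq> \<infinity>" for k
    using proximal_gradient_step[OF hyps, of "x k"] unfolding xbar_def F_def by (metis PInfty_neq_ereal(1))
  have descent: "F (xbar L f \<Psi> x k) \<le> F (xbar L f \<Psi> x (k - 1))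
      - ereal (1 / (2 * L) * (norm (G (x k)))\<^sup>2)" if "k \<ge> 1" for k
    using proximal_gradient_descent[OF hyps, of "x k"] xmin[OF that xbar_in[OF that]]
    unfolding xbar_def F_def G_def by (meson ereal_minus_mono order_refl order_trans)
  have F_x: "\<exists>c. F (x k) = ereal c" if "k \<ge> 1" for k
    using xmin[OF that xbar_in[OF that]] F_xbar F_minf
    by (metis ereal_cases ereal_infty_less_eq(1))
  have "potential L f \<Psi> xstar x y (k + 1) \<le> potential L f \<Psi> xstar x y k"
    if conv: "convex_on UNIV f" and k: "k \<ge> 1" for k
  proof -
    obtain c where c: "F (x k) = ereal c" using F_x[OF k] by blast
    obtain c' where c': "F (x (k + 1)) = ereal c'" using F_x[of "k + 1"] by auto
    obtain m where m: "F xstar = ereal m"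
      using F_xstar[of "x k"] F_minf[of xstar] c by (cases "F xstar") auto
    define g where "g = G (z k)"
    define q where "q = (norm g)\<^sup>2 / (2 * L)"
    obtain d where d: "F (z k - (1 / L) *\<^sub>R g) = ereal d"
      "\<And>u b. F u = ereal b \<Longrightarrow> d + g \<bullet> (u - z k) + q \<le> b"
      using proximal_gradient_convex[OF hyps conv, of "z k"]
      unfolding F_def g_def G_def q_def by blast
    have "F (x (k + 1)) \<le> F (z k - (1 / L) *\<^sub>R g)"
      using M(1)[OF k] line unfolding g_def by (intro xmin) auto
    then have "c' \<le> d" unfolding c' d(1) by simp
    \<comment> \<open>Twice this step length is the increase of the coefficient
      \<open>k * (k + 1) / (2 * L)\<close> in the potential from \<open>k\<close> to
      \<open>k + 1\<close>.\<close>
    define \<alpha> where "\<alpha> = (real k + 1) / (2 * L)"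
    have "(norm (y (k + 1) - xstar))\<^sup>2 \<le> (norm (y k - \<alpha> *\<^sub>R g - xstar))\<^sup>2"
      using M(2)[OF k] line unfolding g_def by (intro ymin) auto
    also have "\<dots> = (norm (y k - xstar))\<^sup>2 - 2 * \<alpha> * (g \<bullet> (y k - xstar)) + \<alpha>\<^sup>2 * (norm g)\<^sup>2"
      unfolding power2_norm_eq_inner
      by (simp add: inner_diff_left inner_diff_right inner_commute power2_eq_square algebra_simps)
    also have "(norm g)\<^sup>2 = 2 * L * q"
      using assms(1) by (simp add: q_def)
    finally have y: "(norm (y (k + 1) - xstar))\<^sup>2
        \<le> (norm (y k - xstar))\<^sup>2 - 2 * \<alpha> * (g \<bullet> (y k - xstar)) + \<alpha>\<^sup>2 * (2 * L * q)" .
    have "(norm (y (k + 1) - xstar))\<^sup>2 + (real k + 1) * (real k + 2) * (c' - m) / (2 * L)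
        \<le> (norm (y k - xstar))\<^sup>2 + real k * (real k + 1) * (c - m) / (2 * L)"
    proof (rule potential_arith[where a = "g \<bullet> (y k - xstar)" and d = "d - m" and q = q])
      \<comment> \<open>Split \<open>y k - xstar\<close> at \<open>z k\<close>: the first piece has
        nonnegative product with \<open>g\<close> by the choice of \<open>z k\<close>, the second is
        bounded by \<open>d(2)\<close> at \<open>xstar\<close>.\<close>
      show "d - m + q \<le> g \<bullet> (y k - xstar)"
        using d(2)[OF m] Gy[OF k] by (simp add: g_def inner_diff_right)
      \<comment> \<open>The other sign condition on \<open>z k\<close> lets the inner product in
        \<open>d(2)\<close> at \<open>x k\<close> be dropped.\<close>
      show "d - m + q \<le> c - m"
        using d(2)[OF c] Gx[OF k] by (simp add: g_def)
      show "0 \<le> q" using assms(1) by (simp add: q_def)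
    qed (use assms(1) \<open>c' \<le> d\<close> y in \<open>auto simp: \<alpha>_def\<close>)
    then show ?thesis
      using c c' m assms(1) by (simp add: potential_def F_def algebra_simps)
  qed
  with descent show ?thesis by (simp add: F_def G_def)
qed

end
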